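(* Let $\alpha\ge1$ be an integer and $\nu\in\mathbb{C}$. For each triple $\sigma,\tau,\kappa\in\mathrm{PB}(\alpha)$ define $\mathfrak{c}^\kappa_{\sigma,\tau}(\nu)\in\mathbb{C}$ as follows. If $\kappa$ is an extension of $\sigma\tau$ with $\operatorname{dom}\kappa\cap\operatorname{dom}\tau=\operatorname{dom}\sigma\tau$ and $\operatorname{im}\kappa\cap\operatorname{im}\sigma=\operatorname{im}\sigma\tau$, put $$\mathfrak{c}^\kappa_{\sigma,\tau}(\nu)=(\nu-\alpha+\operatorname{rk}\kappa)(\nu-\alpha+\operatorname{rk}\kappa-1)\cdots(\nu-2\alpha+\operatorname{rk}\sigma+\operatorname{rk}\tau-\operatorname{rk}\sigma\tau+\operatorname{rk}\kappa+1)=(-1)^l(-\nu+\alpha-\operatorname{rk}\kappa)_l,$$ where $l:=\alpha+\operatorname{rk}\sigma\tau-\operatorname{rk}\sigma-\operatorname{rk}\tau$ (which is $\ge0$) is the number of factors; otherwise put $\mathfrak{c}^\kappa_{\sigma,\tau}(\nu)=0$. Consider the linear space $\mathbb{C}^{\#\mathrm{PB}(\alpha)}$ with basis the symbols $\Xi(\sigma)$, $\sigma\in\mathrm{PB}(\alpha)$. Then for any $\nu\in\mathbb{C}$ the formula $$\Xi(\sigma)\,\Xi(\tau)=\sum_{\kappa\in\mathrm{PB}(\alpha)}\mathfrak{c}^\kappa_{\sigma,\tau}(\nu)\,\Xi(\kappa)$$ determines a structure of an associative algebra on this space.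
   Context: $\Omega_\alpha=\{1,\dots,\alpha\}$. A partial bijection $\sigma$ of $\Omega_\alpha$ is a bijection from a subset $\operatorname{dom}\sigma\subset\Omega_\alpha$ onto a subset $\operatorname{im}\sigma\subset\Omega_\alpha$; $\operatorname{rk}\sigma=\#\operatorname{dom}\sigma$. The product $\sigma\tau$ is composition of partially defined maps: $\operatorname{dom}\sigma\tau=\{a\in\operatorname{dom}\tau:\tau(a)\in\operatorname{dom}\sigma\}$, $(\sigma\tau)(a)=\sigma(\tau(a))$. $\mathrm{PB}(\alpha)$ is the semigroup of all partial bijections of $\Omega_\alpha$. $\kappa$ is an extension of $\phi$ if $\operatorname{dom}\kappa\supset\operatorname{dom}\phi$ and $\kappa|_{\operatorname{dom}\phi}=\phi$. $(p)_k=p(p+1)\cdots(p+k-1)$ is the Pochhammer symbol, $(p)_0=1$. *)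

theory Defs
  imports Complex_Main "HOL-Library.Function_Algebras"
begin

definition PB :: "nat \<Rightarrow> (nat \<rightharpoonup> nat) set" where
  "PB \<alpha> = {\<sigma>. dom \<sigma> \<subseteq> {1..\<alpha>} \<and> ran \<sigma> \<subseteq> {1..\<alpha>} \<and> inj_on \<sigma> (dom \<sigma>)}"

definition rk :: "(nat \<rightharpoonup> nat) \<Rightarrow> nat" where
  "rk \<sigma> = card (dom \<sigma>)"

definition num_factors :: "nat \<Rightarrow> (nat \<rightharpoonup> nat) \<Rightarrow> (nat \<rightharpoonup> nat) \<Rightarrow> int" where
  "num_factors \<alpha> \<sigma> \<tau> = int \<alpha> + int (rk (\<sigma> \<circ>\<^sub>m \<tau>)) - int (rk \<sigma>) - int (rk \<tau>)"

definition admissible :: "(nat \<rightharpoonup> nat) \<Rightarrow> (nat \<rightharpoonup> nat) \<Rightarrow> (nat \<rightharpoonup> nat) \<Rightarrow> bool" where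
  "admissible \<sigma> \<tau> \<kappa> \<longleftrightarrow>
     \<sigma> \<circ>\<^sub>m \<tau> \<subseteq>\<^sub>m \<kappa> \<and>
     dom \<kappa> \<inter> dom \<tau> = dom (\<sigma> \<circ>\<^sub>m \<tau>) \<and>
     ran \<kappa> \<inter> ran \<sigma> = ran (\<sigma> \<circ>\<^sub>m \<tau>)"

text \<open>
  The factors of a nonzero structure constant are the numbers \<open>\<nu> + m\<close>, where the integer \<open>m\<close>
  decreases from \<open>- \<alpha> + rk \<kappa>\<close> to \<open>- 2\<alpha> + rk \<sigma> + rk \<tau> - rk (\<sigma>\<tau>) + rk \<kappa> + 1\<close>.
\<close>

definition factor_shifts ::
  "nat \<Rightarrow> (nat \<rightharpoonup> nat) \<Rightarrow> (nat \<rightharpoonup> nat) \<Rightarrow> (nat \<rightharpoonup> nat) \<Rightarrow> int set" where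
  "factor_shifts \<alpha> \<sigma> \<tau> \<kappa> =
     {- 2 * int \<alpha> + int (rk \<sigma>) + int (rk \<tau>) - int (rk (\<sigma> \<circ>\<^sub>m \<tau>)) + int (rk \<kappa>) + 1 ..
      - int \<alpha> + int (rk \<kappa>)}"

definition struct_const ::
  "nat \<Rightarrow> complex \<Rightarrow> (nat \<rightharpoonup> nat) \<Rightarrow> (nat \<rightharpoonup> nat) \<Rightarrow> (nat \<rightharpoonup> nat) \<Rightarrow> complex" where
  "struct_const \<alpha> \<nu> \<sigma> \<tau> \<kappa> =
     (if admissible \<sigma> \<tau> \<kappa> then \<Prod>m\<in>factor_shifts \<alpha> \<sigma> \<tau> \<kappa>. \<nu> + of_int m else 0)"

definition scale :: "complex \<Rightarrow> ('b \<Rightarrow> complex) \<Rightarrow> 'b \<Rightarrow> complex" where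
  "scale c f = (\<lambda>x. c * f x)"

definition coord_space :: "'b set \<Rightarrow> ('b \<Rightarrow> complex) set" where
  "coord_space B = {f. \<forall>x. x \<notin> B \<longrightarrow> f x = 0}"

definition Xi :: "'b \<Rightarrow> 'b \<Rightarrow> complex" where
  "Xi \<sigma> = (\<lambda>\<rho>. if \<rho> = \<sigma> then 1 else 0)"

interpretation fun_space: vector_space scale
  by unfold_locales (auto simp: scale_def fun_eq_iff algebra_simps)

lemma sum_fun_apply: "(\<Sum>b\<in>B. f b) x = (\<Sum>b\<in>B. (f b x :: complex))"
  by (induction B rule: infinite_finite_induct) auto

lemma inj_Xi: "inj Xi"
  by (auto simp: inj_def Xi_def fun_eq_iff split: if_splits)

lemma coord_space_expand:
  assumes "finite B" "f \<in> coord_space B"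
  shows "f = (\<Sum>b\<in>B. scale (f b) (Xi b))"
  using assms by (auto simp: fun_eq_iff sum_fun_apply scale_def Xi_def coord_space_def
      if_distrib cong: if_cong)

lemma subspace_coord_space: "fun_space.subspace (coord_space B)"
  by (auto simp: fun_space.subspace_def coord_space_def scale_def)

text \<open>For finite \<open>B\<close>, the space \<open>coord_space B\<close> has basis \<open>Xi b\<close>, \<open>b \<in> B\<close>.\<close>

lemma span_Xi:
  assumes "finite B"
  shows "fun_space.span (Xi ` B) = coord_space B"
proof
  show "fun_space.span (Xi ` B) \<subseteq> coord_space B"
    by (rule fun_space.span_minimal[OF _ subspace_coord_space])
       (auto simp: coord_space_def Xi_def)
  show "coord_space B \<subseteq> fun_space.span (Xi ` B)"
  proof
    fix f assume "f \<in> coord_space B"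
    then have "f = (\<Sum>b\<in>B. scale (f b) (Xi b))" by (rule coord_space_expand[OF assms])
    also have "\<dots> \<in> fun_space.span (Xi ` B)"
      by (intro fun_space.span_sum fun_space.span_scale fun_space.span_base imageI)
    finally show "f \<in> fun_space.span (Xi ` B)" .
  qed
qed

lemma independent_Xi: "\<not> fun_space.dependent (Xi ` B)"
proof
  assume "fun_space.dependent (Xi ` B)"
  then obtain b where b: "b \<in> B" and *: "Xi b \<in> fun_space.span (Xi ` B - {Xi b})"
    by (auto simp: fun_space.dependent_def)
  have "fun_space.span (Xi ` B - {Xi b}) \<subseteq> coord_space (- {b})"
    by (rule fun_space.span_minimal[OF _ subspace_coord_space])
       (auto simp: coord_space_def Xi_def)
  with * show False by (auto simp: coord_space_def Xi_def)
qed

lemma finite_PB: "finite (PB \<alpha>)"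
proof -
  have "PB \<alpha> \<subseteq> (\<Union>D\<in>Pow {1..\<alpha>}. {\<sigma>. dom \<sigma> = D \<and> ran \<sigma> \<subseteq> {1..\<alpha>}})"
    by (auto simp: PB_def)
  moreover have "finite \<dots>"
    by (intro finite_UN_I finite_set_of_finite_maps) (auto intro: finite_subset)
  ultimately show ?thesis by (rule finite_subset)
qed

definition bilinear_product_on ::
  "('b \<Rightarrow> complex) set \<Rightarrow> (('b \<Rightarrow> complex) \<Rightarrow> ('b \<Rightarrow> complex) \<Rightarrow> ('b \<Rightarrow> complex)) \<Rightarrow> bool" where
  "bilinear_product_on V mul \<longleftrightarrow>
     (\<forall>x\<in>V. \<forall>y\<in>V. mul x y \<in> V) \<and>
     (\<forall>x\<in>V. \<forall>y\<in>V. \<forall>z\<in>V. mul (x + y) z = mul x z + mul y z) \<and>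
     (\<forall>x\<in>V. \<forall>y\<in>V. \<forall>z\<in>V. mul x (y + z) = mul x y + mul x z) \<and>
     (\<forall>c. \<forall>x\<in>V. \<forall>y\<in>V. mul (scale c x) y = scale c (mul x y)) \<and>
     (\<forall>c. \<forall>x\<in>V. \<forall>y\<in>V. mul x (scale c y) = scale c (mul x y))"

definition associative_algebra_on ::
  "('b \<Rightarrow> complex) set \<Rightarrow> (('b \<Rightarrow> complex) \<Rightarrow> ('b \<Rightarrow> complex) \<Rightarrow> ('b \<Rightarrow> complex)) \<Rightarrow> bool" where
  "associative_algebra_on V mul \<longleftrightarrow>
     fun_space.subspace V \<and> bilinear_product_on V mul \<and>
     (\<forall>x\<in>V. \<forall>y\<in>V. \<forall>z\<in>V. mul (mul x y) z = mul x (mul y z))"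

definition product_formula ::
  "nat \<Rightarrow> complex \<Rightarrow>
   (((nat \<rightharpoonup> nat) \<Rightarrow> complex) \<Rightarrow> ((nat \<rightharpoonup> nat) \<Rightarrow> complex) \<Rightarrow> ((nat \<rightharpoonup> nat) \<Rightarrow> complex)) \<Rightarrow> bool" where
  "product_formula \<alpha> \<nu> mul \<longleftrightarrow>
     (\<forall>\<sigma>\<in>PB \<alpha>. \<forall>\<tau>\<in>PB \<alpha>.
        mul (Xi \<sigma>) (Xi \<tau>) = (\<Sum>\<kappa>\<in>PB \<alpha>. scale (struct_const \<alpha> \<nu> \<sigma> \<tau> \<kappa>) (Xi \<kappa>)))"

end

theory Submission
  imports Defs "HOL-Library.FuncSet" "HOL-Computational_Algebra.Polynomial"
begin

text \<open>
  The structure constants count something whenever \<open>\<nu> = n\<close> is a natural number. Let \<open>P\<close> be a set of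
  \<open>\<alpha> + n\<close> points and consider injections of \<open>\<Omega> = {1..\<alpha>}\<close> into \<open>P\<close>. A pair \<open>(x, y)\<close> of injections has
  a coincidence pattern, the partial bijection \<open>j \<mapsto> i\<close> defined by \<open>x i = y j\<close>; two pairs have the same
  pattern iff they lie in the same orbit of the symmetric group of \<open>P\<close>. If \<open>(x, y)\<close> has pattern
  \<open>\<kappa>\<close>, then \<open>struct_const \<alpha> n \<sigma> \<tau> \<kappa>\<close> is the number of injections \<open>z\<close> for which \<open>(x, z)\<close> has
  pattern \<open>\<sigma>\<close> and \<open>(z, y)\<close> has pattern \<open>\<tau>\<close> (lemma \<open>card_middle_injections\<close>). Indeed, these
  conditions determine \<open>z\<close> on \<open>dom \<sigma> \<union> ran \<tau>\<close>, admissibility of \<open>\<kappa>\<close> is exactly what makes them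
  consistent, and the remaining \<open>l = num_factors \<alpha> \<sigma> \<tau>\<close> values are any distinct points outside \<open>x(\<Omega>) \<union> y(\<Omega>)\<close>, a set with
  \<open>n - \<alpha> + rk \<kappa>\<close> points: hence the falling factorial with \<open>l\<close> factors.

  Associativity at \<open>\<nu> = n\<close> is then a double count of the pairs \<open>(z, w)\<close> for which \<open>(x, z)\<close>,
  \<open>(z, w)\<close> and \<open>(w, y)\<close> have given patterns (lemma \<open>struct_const_assoc_of_nat\<close>), available for
  every \<open>\<kappa>\<close> that is the pattern of some pair, so for all \<open>\<kappa>\<close> as soon as \<open>n \<ge> \<alpha>\<close>. For fixed
  partial bijections both sides of the associativity relation are polynomials in \<open>\<nu>\<close>, and
  polynomials that agree at all large natural numbers are equal (lemma \<open>struct_const_assoc\<close>).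
\<close>

section \<open>Partial bijections\<close>

lemma PB_D:
  assumes "\<sigma> \<in> PB \<alpha>"
  shows "\<sigma> k = Some i \<Longrightarrow> k \<in> {1..\<alpha>}" "\<sigma> k = Some i \<Longrightarrow> i \<in> {1..\<alpha>}"
    "\<sigma> k = Some i \<Longrightarrow> \<sigma> k' = Some i \<Longrightarrow> k = k'"
  using assms by (auto simp: PB_def inj_on_def dom_def ran_def)

lemma PB_I:
  assumes "\<And>k i. \<sigma> k = Some i \<Longrightarrow> k \<in> {1..\<alpha>} \<and> i \<in> {1..\<alpha>}"
    and "\<And>k k' i. \<sigma> k = Some i \<Longrightarrow> \<sigma> k' = Some i \<Longrightarrow> k = k'"
  shows "\<sigma> \<in> PB \<alpha>"
  using assms unfolding PB_def inj_on_def dom_def ran_def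
  by (auto simp del: atLeastAtMost_iff)

lemma finite_dom_PB: "\<sigma> \<in> PB \<alpha> \<Longrightarrow> finite (dom \<sigma>)"
  by (auto simp: PB_def intro: finite_subset)

lemma finite_ran_PB: "\<sigma> \<in> PB \<alpha> \<Longrightarrow> finite (ran \<sigma>)"
  by (auto simp: PB_def intro: finite_subset)

lemma card_ran_inj: "inj_on \<sigma> (dom \<sigma>) \<Longrightarrow> card (ran \<sigma>) = card (dom \<sigma>)"
proof -
  assume inj: "inj_on \<sigma> (dom \<sigma>)"
  have "ran \<sigma> = (the \<circ> \<sigma>) ` dom \<sigma>"
    by (force simp: ran_def dom_def image_iff)
  moreover have "inj_on (the \<circ> \<sigma>) (dom \<sigma>)"
    using inj by (auto simp: inj_on_def dom_def)
  ultimately show ?thesis by (metis card_image)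
qed

lemma rk_eq_card_ran: "\<sigma> \<in> PB \<alpha> \<Longrightarrow> card (ran \<sigma>) = rk \<sigma>"
  by (simp add: PB_def rk_def card_ran_inj)

text \<open>A point of \<open>dom \<sigma>\<tau>\<close> is determined by its image under \<open>\<tau>\<close>, the intermediate point of the
  composition.\<close>
lemma rk_comp_eq_card:
  assumes "\<sigma> \<in> PB \<alpha>" "\<tau> \<in> PB \<alpha>"
  shows "rk (\<sigma> \<circ>\<^sub>m \<tau>) = card (dom \<sigma> \<inter> ran \<tau>)"
proof -
  have "inj_on (the \<circ> \<tau>) (dom (\<sigma> \<circ>\<^sub>m \<tau>))"
  proof (rule inj_onI)
    fix j j' assume "j \<in> dom (\<sigma> \<circ>\<^sub>m \<tau>)" "j' \<in> dom (\<sigma> \<circ>\<^sub>m \<tau>)" "(the \<circ> \<tau>) j = (the \<circ> \<tau>) j'"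
    then obtain k where "\<tau> j = Some k" "\<tau> j' = Some k"
      by (auto simp: dom_def map_comp_Some_iff)
    then show "j = j'" by (rule PB_D(3)[OF assms(2)])
  qed
  moreover have "(the \<circ> \<tau>) ` dom (\<sigma> \<circ>\<^sub>m \<tau>) = dom \<sigma> \<inter> ran \<tau>"
  proof
    show "(the \<circ> \<tau>) ` dom (\<sigma> \<circ>\<^sub>m \<tau>) \<subseteq> dom \<sigma> \<inter> ran \<tau>"
      by (auto simp: dom_def ran_def map_comp_Some_iff)
    show "dom \<sigma> \<inter> ran \<tau> \<subseteq> (the \<circ> \<tau>) ` dom (\<sigma> \<circ>\<^sub>m \<tau>)"
    proof
      fix k assume "k \<in> dom \<sigma> \<inter> ran \<tau>"
      then obtain i j where "\<sigma> k = Some i" "\<tau> j = Some k" by (auto simp: ran_def)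
      then show "k \<in> (the \<circ> \<tau>) ` dom (\<sigma> \<circ>\<^sub>m \<tau>)" by (intro image_eqI[of _ _ j]) auto
    qed
  qed
  ultimately show ?thesis unfolding rk_def by (metis card_image)
qed

lemma card_dom_Un_ran:
  assumes "\<sigma> \<in> PB \<alpha>" "\<tau> \<in> PB \<alpha>"
  shows "card (dom \<sigma> \<union> ran \<tau>) + rk (\<sigma> \<circ>\<^sub>m \<tau>) = rk \<sigma> + rk \<tau>"
  using card_Un_Int[OF finite_dom_PB[OF assms(1)] finite_ran_PB[OF assms(2)]]
  by (simp add: rk_comp_eq_card[OF assms] rk_eq_card_ran[OF assms(2)] flip: rk_def)

text \<open>Inclusion-exclusion identifies the number of factors with the number of points at which
  neither \<open>\<sigma>\<close> nor the inverse of \<open>\<tau>\<close> is defined; in particular it is nonnegative.\<close>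
lemma num_factors_eq_card:
  assumes "\<sigma> \<in> PB \<alpha>" "\<tau> \<in> PB \<alpha>"
  shows "num_factors \<alpha> \<sigma> \<tau> = int (card ({1..\<alpha>} - (dom \<sigma> \<union> ran \<tau>)))"
proof -
  have sub: "dom \<sigma> \<union> ran \<tau> \<subseteq> {1..\<alpha>}" using assms by (auto simp: PB_def)
  have "card ({1..\<alpha>} - (dom \<sigma> \<union> ran \<tau>)) = \<alpha> - card (dom \<sigma> \<union> ran \<tau>)"
    using sub by (subst card_Diff_subset) (auto intro: finite_subset)
  moreover have "card (dom \<sigma> \<union> ran \<tau>) \<le> \<alpha>"
    using card_mono[OF _ sub] by simp
  ultimately show ?thesis
    using card_dom_Un_ran[OF assms] by (simp add: num_factors_def)
qed

text \<open>In this form admissibility is the transitivity of equality: if \<open>\<sigma> k = i\<close>, \<open>\<tau> j = k\<close> and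
  \<open>\<kappa> j = i\<close> encode \<open>x i = z k\<close>, \<open>z k = y j\<close> and \<open>x i = y j\<close>, then any two of these equalities
  imply the third.\<close>
lemma admissible_iff:
  assumes "\<sigma> \<in> PB \<alpha>" "\<tau> \<in> PB \<alpha>" "\<kappa> \<in> PB \<alpha>"
  shows "admissible \<sigma> \<tau> \<kappa> \<longleftrightarrow>
    (\<forall>i j k. (\<sigma> k = Some i \<and> \<tau> j = Some k \<longrightarrow> \<kappa> j = Some i) \<and>
             (\<tau> j = Some k \<and> \<kappa> j = Some i \<longrightarrow> \<sigma> k = Some i) \<and>
             (\<sigma> k = Some i \<and> \<kappa> j = Some i \<longrightarrow> \<tau> j = Some k))"
    (is "_ \<longleftrightarrow> ?R")
proof
  assume adm: "admissible \<sigma> \<tau> \<kappa>"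
  have ext: "\<kappa> j = Some i" if "\<sigma> k = Some i" "\<tau> j = Some k" for i j k
  proof -
    have *: "(\<sigma> \<circ>\<^sub>m \<tau>) j = Some i" using that by simp
    moreover have "\<sigma> \<circ>\<^sub>m \<tau> \<subseteq>\<^sub>m \<kappa>" using adm by (simp add: admissible_def)
    ultimately have "(\<sigma> \<circ>\<^sub>m \<tau>) j = \<kappa> j" by (simp add: map_le_def dom_def)
    with * show ?thesis by simp
  qed
  have two: "\<sigma> k = Some i" if "\<tau> j = Some k" "\<kappa> j = Some i" for i j k
  proof -
    have "j \<in> dom (\<sigma> \<circ>\<^sub>m \<tau>)" using adm that unfolding admissible_def by blast
    with that(1) obtain i' where "\<sigma> k = Some i'" by auto
    with ext[OF this that(1)] that show ?thesis by simp
  qed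
  have three: "\<tau> j = Some k" if "\<sigma> k = Some i" "\<kappa> j = Some i" for i j k
  proof -
    have "i \<in> ran \<kappa> \<inter> ran \<sigma>" using that by (auto simp: ran_def)
    then have "i \<in> ran (\<sigma> \<circ>\<^sub>m \<tau>)" using adm unfolding admissible_def by simp
    then obtain j' k' where *: "\<tau> j' = Some k'" "\<sigma> k' = Some i"
      by (auto simp: ran_def map_comp_Some_iff)
    have "k = k'" using that(1) *(2) by (rule PB_D(3)[OF assms(1)])
    moreover have "j = j'" using that(2) ext[OF *(2,1)] by (rule PB_D(3)[OF assms(3)])
    ultimately show ?thesis using *(1) by simp
  qed
  show ?R using ext two three by blast
next
  assume R: ?R
  have le: "(\<sigma> \<circ>\<^sub>m \<tau>) \<subseteq>\<^sub>m \<kappa>"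
    unfolding map_le_def
  proof
    fix j assume "j \<in> dom (\<sigma> \<circ>\<^sub>m \<tau>)"
    then obtain i k where "\<tau> j = Some k" "\<sigma> k = Some i"
      by (auto simp: map_comp_Some_iff)
    moreover from this R have "\<kappa> j = Some i" by blast
    ultimately show "(\<sigma> \<circ>\<^sub>m \<tau>) j = \<kappa> j" by simp
  qed
  have "dom \<kappa> \<inter> dom \<tau> = dom (\<sigma> \<circ>\<^sub>m \<tau>)"
  proof
    show "dom \<kappa> \<inter> dom \<tau> \<subseteq> dom (\<sigma> \<circ>\<^sub>m \<tau>)"
    proof
      fix j assume "j \<in> dom \<kappa> \<inter> dom \<tau>"
      then obtain i k where "\<kappa> j = Some i" "\<tau> j = Some k" by blast
      with R have "\<sigma> k = Some i" by blast
      with \<open>\<tau> j = Some k\<close> show "j \<in> dom (\<sigma> \<circ>\<^sub>m \<tau>)" by auto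
    qed
    show "dom (\<sigma> \<circ>\<^sub>m \<tau>) \<subseteq> dom \<kappa> \<inter> dom \<tau>"
      using map_le_implies_dom_le[OF le] by (auto simp: map_comp_Some_iff)
  qed
  moreover have "ran \<kappa> \<inter> ran \<sigma> = ran (\<sigma> \<circ>\<^sub>m \<tau>)"
  proof
    show "ran \<kappa> \<inter> ran \<sigma> \<subseteq> ran (\<sigma> \<circ>\<^sub>m \<tau>)"
    proof
      fix i assume "i \<in> ran \<kappa> \<inter> ran \<sigma>"
      then obtain j k where "\<kappa> j = Some i" and k: "\<sigma> k = Some i" by (auto simp: ran_def)
      with R have "\<tau> j = Some k" by blast
      with k have "(\<sigma> \<circ>\<^sub>m \<tau>) j = Some i" by simp
      then show "i \<in> ran (\<sigma> \<circ>\<^sub>m \<tau>)" by (rule ranI)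
    qed
    show "ran (\<sigma> \<circ>\<^sub>m \<tau>) \<subseteq> ran \<kappa> \<inter> ran \<sigma>"
    proof
      fix i assume "i \<in> ran (\<sigma> \<circ>\<^sub>m \<tau>)"
      then obtain j k where "\<tau> j = Some k" and k: "\<sigma> k = Some i"
        by (auto simp: ran_def map_comp_Some_iff)
      with R have "\<kappa> j = Some i" by blast
      with k show "i \<in> ran \<kappa> \<inter> ran \<sigma>" by (auto intro: ranI)
    qed
  qed
  ultimately show "admissible \<sigma> \<tau> \<kappa>" using le unfolding admissible_def by simp
qed

section \<open>The structure constants\<close>

lemma prod_factor_shifts:
  assumes "0 \<le> num_factors \<alpha> \<sigma> \<tau>"
  shows "(\<Prod>m\<in>factor_shifts \<alpha> \<sigma> \<tau> \<kappa>. \<nu> + of_int m) =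
    (\<Prod>i<nat (num_factors \<alpha> \<sigma> \<tau>). \<nu> - of_nat \<alpha> + of_nat (rk \<kappa>) - of_nat i)"
proof -
  let ?l = "num_factors \<alpha> \<sigma> \<tau>" and ?M = "int (rk \<kappa>) - int \<alpha>"
  have "factor_shifts \<alpha> \<sigma> \<tau> \<kappa> = {?M - ?l + 1 .. ?M}"
    by (simp add: factor_shifts_def num_factors_def algebra_simps)
  also have "\<dots> = (\<lambda>i. ?M - int i) ` {..<nat ?l}"
  proof
    show "{?M - ?l + 1 .. ?M} \<subseteq> (\<lambda>i. ?M - int i) ` {..<nat ?l}"
    proof
      fix m assume "m \<in> {?M - ?l + 1 .. ?M}"
      then show "m \<in> (\<lambda>i. ?M - int i) ` {..<nat ?l}"
        by (intro image_eqI[of _ _ "nat (?M - m)"]) auto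
    qed
  qed auto
  finally have "factor_shifts \<alpha> \<sigma> \<tau> \<kappa> = (\<lambda>i. ?M - int i) ` {..<nat ?l}" .
  moreover have "inj_on (\<lambda>i. ?M - int i) {..<nat ?l}" by (auto simp: inj_on_def)
  ultimately show ?thesis
    by (simp add: prod.reindex algebra_simps)
qed

lemma prod_falling_eq_pochhammer:
  fixes a :: "'a::comm_ring_1"
  shows "(\<Prod>i<k. a - of_nat i) = (-1) ^ k * pochhammer (- a) k"
  by (induction k) (simp_all add: pochhammer_Suc algebra_simps)

lemma struct_const_eq_pochhammer:
  assumes "\<sigma> \<in> PB \<alpha>" "\<tau> \<in> PB \<alpha>" "admissible \<sigma> \<tau> \<kappa>"
  shows "struct_const \<alpha> \<nu> \<sigma> \<tau> \<kappa> =
    (-1) ^ nat (num_factors \<alpha> \<sigma> \<tau>) *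
    pochhammer (- \<nu> + of_nat \<alpha> - of_nat (rk \<kappa>)) (nat (num_factors \<alpha> \<sigma> \<tau>))"
  using assms
  by (simp add: struct_const_def prod_factor_shifts num_factors_eq_card
      prod_falling_eq_pochhammer)

lemma card_factor_shifts:
  assumes "0 \<le> num_factors \<alpha> \<sigma> \<tau>"
  shows "int (card (factor_shifts \<alpha> \<sigma> \<tau> \<kappa>)) = num_factors \<alpha> \<sigma> \<tau>"
  using assms by (simp add: factor_shifts_def num_factors_def)

text \<open>For fixed partial bijections the set of shifts does not depend on \<open>\<nu>\<close>, so the structure
  constant is zero or a product of a fixed number of linear factors in \<open>\<nu>\<close>.\<close>
lemma struct_const_polynomial:
  "\<exists>p. \<forall>\<nu>. struct_const \<alpha> \<nu> \<sigma> \<tau> \<kappa> = poly p \<nu>"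
  by (intro exI[of _ "if admissible \<sigma> \<tau> \<kappa>
        then \<Prod>m\<in>factor_shifts \<alpha> \<sigma> \<tau> \<kappa>. [:of_int m, 1:] else 0"])
     (simp add: struct_const_def poly_prod add.commute)

section \<open>Pairs of injections and their coincidence patterns\<close>

definition injections :: "nat \<Rightarrow> 'a set \<Rightarrow> (nat \<Rightarrow> 'a) set" where
  "injections \<alpha> P = {x \<in> {1..\<alpha>} \<rightarrow>\<^sub>E P. inj_on x {1..\<alpha>}}"

text \<open>The partial map \<open>x\<^sup>-\<^sup>1 \<circ> y\<close>. The order of the arguments makes patterns compose like maps:
  the pattern of \<open>(x, y)\<close> extends the product of those of \<open>(x, z)\<close> and \<open>(z, y)\<close>.\<close>
definition pattern :: "nat \<Rightarrow> (nat \<Rightarrow> 'a) \<Rightarrow> (nat \<Rightarrow> 'a) \<Rightarrow> nat \<rightharpoonup> nat" where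
  "pattern \<alpha> x y j =
     (if j \<in> {1..\<alpha>} \<and> y j \<in> x ` {1..\<alpha>} then Some (inv_into {1..\<alpha>} x (y j)) else None)"

lemma pattern_Some_iff:
  assumes "x \<in> injections \<alpha> P"
  shows "pattern \<alpha> x y j = Some i \<longleftrightarrow> i \<in> {1..\<alpha>} \<and> j \<in> {1..\<alpha>} \<and> x i = y j"
proof -
  have inj: "inj_on x {1..\<alpha>}" using assms by (simp add: injections_def)
  have "y j \<in> x ` {1..\<alpha>} \<and> inv_into {1..\<alpha>} x (y j) = i \<longleftrightarrow> i \<in> {1..\<alpha>} \<and> x i = y j"
    using inv_into_f_eq[OF inj] f_inv_into_f inv_into_into imageI by metis
  then show ?thesis unfolding pattern_def by (auto simp del: atLeastAtMost_iff)
qed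

lemma injections_eqD:
  assumes "x \<in> injections \<alpha> P" "i \<in> {1..\<alpha>}" "j \<in> {1..\<alpha>}" "x i = x j"
  shows "i = j"
proof -
  have "inj_on x {1..\<alpha>}" using assms(1) by (simp add: injections_def)
  from inj_onD[OF this assms(4,2,3)] show ?thesis .
qed

lemma pattern_in_PB:
  assumes "x \<in> injections \<alpha> P" "y \<in> injections \<alpha> P"
  shows "pattern \<alpha> x y \<in> PB \<alpha>"
proof (rule PB_I)
  fix j j' i assume "pattern \<alpha> x y j = Some i" "pattern \<alpha> x y j' = Some i"
  then have "j \<in> {1..\<alpha>}" "j' \<in> {1..\<alpha>}" "y j = y j'"
    unfolding pattern_Some_iff[OF assms(1)] by auto
  then show "j = j'" by (rule injections_eqD[OF assms(2)])
qed (simp add: pattern_Some_iff[OF assms(1)])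

lemma finite_injections: "finite P \<Longrightarrow> finite (injections \<alpha> P)"
  unfolding injections_def by (rule finite_subset[OF Collect_restrict finite_PiE]) auto

lemma pattern_eq_iff:
  assumes "x \<in> injections \<alpha> P"
  shows "pattern \<alpha> x y = \<sigma> \<longleftrightarrow>
    (\<forall>i j. \<sigma> j = Some i \<longleftrightarrow> i \<in> {1..\<alpha>} \<and> j \<in> {1..\<alpha>} \<and> x i = y j)"
proof -
  have "pattern \<alpha> x y = \<sigma> \<longleftrightarrow> (\<forall>i j. \<sigma> j = Some i \<longleftrightarrow> pattern \<alpha> x y j = Some i)"
  proof
    assume *: "\<forall>i j. \<sigma> j = Some i \<longleftrightarrow> pattern \<alpha> x y j = Some i"
    show "pattern \<alpha> x y = \<sigma>"
    proof
      fix j show "pattern \<alpha> x y j = \<sigma> j"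
        using * by (metis not_None_eq)
    qed
  qed simp
  then show ?thesis unfolding pattern_Some_iff[OF assms] .
qed

text \<open>Let \<open>y\<close> be the inclusion and let \<open>x\<close> send \<open>i\<close> to its preimage under \<open>\<kappa>\<close>, or to the
  fresh point \<open>\<alpha> + i\<close> if there is none. The hypothesis \<open>\<alpha> \<le> n\<close> provides the fresh points.\<close>
lemma pattern_surjective:
  assumes "\<kappa> \<in> PB \<alpha>" "\<alpha> \<le> n"
  shows "\<exists>x\<in>injections \<alpha> {1..\<alpha> + n}. \<exists>y\<in>injections \<alpha> {1..\<alpha> + n}. pattern \<alpha> x y = \<kappa>"
proof -
  let ?\<Omega> = "{1..\<alpha>}"
  define x where "x = (\<lambda>i\<in>?\<Omega>. if i \<in> ran \<kappa> then SOME j. \<kappa> j = Some i else \<alpha> + i)"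
  define y where "y = (\<lambda>j\<in>?\<Omega>. j)"
  have x_ran: "x i = j" if "\<kappa> j = Some i" for i j
  proof -
    have "(SOME j. \<kappa> j = Some i) = j"
      using that PB_D(3)[OF assms(1)] by blast
    moreover have "i \<in> ran \<kappa>" "i \<in> ?\<Omega>"
      using that PB_D[OF assms(1)] by (auto simp: ran_def)
    ultimately show ?thesis by (simp add: x_def)
  qed
  have x_out: "x i = \<alpha> + i" if "i \<in> ?\<Omega>" "i \<notin> ran \<kappa>" for i
    using that by (simp add: x_def)
  have x_cases: "(\<kappa> (x i) = Some i \<and> x i \<in> ?\<Omega>) \<or> x i = \<alpha> + i" if "i \<in> ?\<Omega>" for i
  proof (cases "i \<in> ran \<kappa>")
    case True
    then obtain j where j: "\<kappa> j = Some i" by (auto simp: ran_def)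
    with x_ran[OF j] PB_D(1)[OF assms(1) j] show ?thesis by simp
  qed (use x_out that in simp)
  have x: "x \<in> injections \<alpha> {1..\<alpha> + n}"
  proof -
    have "x \<in> ?\<Omega> \<rightarrow>\<^sub>E {1..\<alpha> + n}"
    proof (rule PiE_I)
      fix i assume "i \<in> ?\<Omega>"
      from x_cases[OF this] this assms(2) show "x i \<in> {1..\<alpha> + n}" by (elim disjE) simp_all
    next
      fix i assume "i \<notin> ?\<Omega>"
      then show "x i = undefined" unfolding x_def by (simp only: restrict_apply if_False)
    qed
    moreover have "inj_on x ?\<Omega>"
    proof (rule inj_onI)
      fix i i' assume i: "i \<in> ?\<Omega>" "i' \<in> ?\<Omega>" and eq: "x i = x i'"
      show "i = i'"
        using x_cases[OF i(1)] x_cases[OF i(2)] i unfolding eq by (elim disjE) simp_all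
    qed
    ultimately show ?thesis by (simp add: injections_def)
  qed
  have y: "y \<in> injections \<alpha> {1..\<alpha> + n}"
    by (auto simp: injections_def y_def inj_on_def)
  have "pattern \<alpha> x y = \<kappa>"
    unfolding pattern_eq_iff[OF x]
  proof (intro allI)
    fix i j
    show "\<kappa> j = Some i \<longleftrightarrow> i \<in> ?\<Omega> \<and> j \<in> ?\<Omega> \<and> x i = y j"
    proof
      assume j: "\<kappa> j = Some i"
      with x_ran[OF j] PB_D(1,2)[OF assms(1) j]
      show "i \<in> ?\<Omega> \<and> j \<in> ?\<Omega> \<and> x i = y j" by (simp add: y_def)
    next
      assume r: "i \<in> ?\<Omega> \<and> j \<in> ?\<Omega> \<and> x i = y j"
      then have i: "i \<in> ?\<Omega>" and xi: "x i = j" and j: "j \<in> ?\<Omega>" by (simp_all add: y_def)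
      from x_cases[OF i] i j show "\<kappa> j = Some i" unfolding xi by auto
    qed
  qed
  with x y show ?thesis by blast
qed

text \<open>The subtraction on the left is truncated; when that happens, both products contain the
  factor \<open>c - c = 0\<close>.\<close>
lemma of_nat_prod_diff:
  "of_nat (\<Prod>i<k. c - i) = (\<Prod>i<k. of_nat c - of_nat i :: 'a::comm_ring_1)"
proof (cases "k \<le> c")
  case True
  then show ?thesis by (auto simp: of_nat_diff intro!: prod.cong)
next
  case False
  then have "c \<in> {..<k}" by simp
  then have "(\<Prod>i<k. c - i) = 0" and "(\<Prod>i<k. of_nat c - of_nat i :: 'a) = 0"
    by (auto intro!: prod_zero bexI[of _ c])
  then show ?thesis by (simp only: of_nat_0)
qed

text \<open>The rank of the pattern is the number of points common to both images.\<close>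
lemma card_image_Un:
  assumes x: "x \<in> injections \<alpha> P" and y: "y \<in> injections \<alpha> P"
  shows "card (x ` {1..\<alpha>} \<union> y ` {1..\<alpha>}) + rk (pattern \<alpha> x y) = 2 * \<alpha>"
proof -
  let ?\<Omega> = "{1..\<alpha>}"
  have inj: "inj_on x ?\<Omega>" "inj_on y ?\<Omega>" using x y by (auto simp: injections_def)
  have "dom (pattern \<alpha> x y) = {j \<in> ?\<Omega>. y j \<in> x ` ?\<Omega>}"
    by (auto simp: pattern_def dom_def split: if_splits)
  moreover have image_restrict: "y ` {j \<in> D. y j \<in> S} = S \<inter> y ` D" for D S by blast
  ultimately have "y ` dom (pattern \<alpha> x y) = x ` ?\<Omega> \<inter> y ` ?\<Omega>" by (simp only: image_restrict)
  moreover have "inj_on y (dom (pattern \<alpha> x y))"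
    using inj(2) by (rule inj_on_subset) (auto simp: pattern_def dom_def split: if_splits)
  ultimately have "rk (pattern \<alpha> x y) = card (x ` ?\<Omega> \<inter> y ` ?\<Omega>)"
    unfolding rk_def by (metis card_image)
  then show ?thesis
    using card_Un_Int[of "x ` ?\<Omega>" "y ` ?\<Omega>"] inj by (simp add: card_image)
qed

text \<open>The counting interpretation of the structure constants. If the pattern of
  \<open>(x, y)\<close> is not admissible, transitivity of equality excludes every \<open>z\<close>. Otherwise \<open>z\<close> consists of the values forced on \<open>A = dom \<sigma> \<union> ran \<tau>\<close> together with an arbitrary injection of
  \<open>\<Omega> - A\<close> into the set \<open>Q\<close> of points avoided by \<open>x\<close> and \<open>y\<close>: a value of \<open>z\<close> outside \<open>A\<close> that met the
  image of \<open>x\<close> or \<open>y\<close> would produce a coincidence recorded by \<open>\<sigma>\<close> or \<open>\<tau>\<close>.\<close>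
lemma card_middle_injections:
  assumes x: "x \<in> injections \<alpha> P" and y: "y \<in> injections \<alpha> P"
    and P: "finite P" "card P = \<alpha> + n"
    and \<sigma>: "\<sigma> \<in> PB \<alpha>" and \<tau>: "\<tau> \<in> PB \<alpha>"
  shows "of_nat (card {z \<in> injections \<alpha> P. pattern \<alpha> x z = \<sigma> \<and> pattern \<alpha> z y = \<tau>}) =
    struct_const \<alpha> (of_nat n) \<sigma> \<tau> (pattern \<alpha> x y)"
proof -
  define \<kappa> where "\<kappa> = pattern \<alpha> x y"
  let ?\<Omega> = "{1..\<alpha>}"
  let ?Z = "{z \<in> injections \<alpha> P. pattern \<alpha> x z = \<sigma> \<and> pattern \<alpha> z y = \<tau>}"
  have \<kappa>: "\<kappa> \<in> PB \<alpha>" unfolding \<kappa>_def by (rule pattern_in_PB[OF x y])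
  have \<kappa>_iff: "\<kappa> j = Some i \<longleftrightarrow> i \<in> ?\<Omega> \<and> j \<in> ?\<Omega> \<and> x i = y j" for i j
    unfolding \<kappa>_def by (rule pattern_Some_iff[OF x])
  have Z_iff: "z \<in> ?Z \<longleftrightarrow> z \<in> injections \<alpha> P \<and>
      (\<forall>i k. \<sigma> k = Some i \<longleftrightarrow> i \<in> ?\<Omega> \<and> k \<in> ?\<Omega> \<and> x i = z k) \<and>
      (\<forall>k j. \<tau> j = Some k \<longleftrightarrow> k \<in> ?\<Omega> \<and> j \<in> ?\<Omega> \<and> z k = y j)" for z
  proof (cases "z \<in> injections \<alpha> P")
    case True
    then show ?thesis
      by (simp only: mem_Collect_eq pattern_eq_iff[OF x] pattern_eq_iff[OF True])
  qed simp
  have Z\<sigma>: "\<sigma> k = Some i \<longleftrightarrow> i \<in> ?\<Omega> \<and> k \<in> ?\<Omega> \<and> x i = z k" if "z \<in> ?Z" for z i k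
    using that[unfolded Z_iff, THEN conjunct2, THEN conjunct1, THEN spec, THEN spec] .
  have Z\<tau>: "\<tau> j = Some k \<longleftrightarrow> k \<in> ?\<Omega> \<and> j \<in> ?\<Omega> \<and> z k = y j" if "z \<in> ?Z" for z j k
    using that[unfolded Z_iff, THEN conjunct2, THEN conjunct2, THEN spec, THEN spec] .
  show ?thesis
  proof (cases "admissible \<sigma> \<tau> \<kappa>")
    case False
    have "?Z = {}"
    proof (rule ccontr)
      assume "?Z \<noteq> {}"
      then obtain z where z: "z \<in> ?Z" by blast
      have "admissible \<sigma> \<tau> \<kappa>"
        unfolding admissible_iff[OF \<sigma> \<tau> \<kappa>] \<kappa>_iff Z\<sigma>[OF z] Z\<tau>[OF z]
        by (auto simp del: atLeastAtMost_iff)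
      with False show False by simp
    qed
    then show ?thesis using False by (simp only: struct_const_def \<kappa>_def) simp
  next
    case True
    note adm = True[unfolded admissible_iff[OF \<sigma> \<tau> \<kappa>]]
    define A where "A = dom \<sigma> \<union> ran \<tau>"
    define Q where "Q = P - (x ` ?\<Omega> \<union> y ` ?\<Omega>)"
    \<comment> \<open>the values that a middle injection is forced to take on \<open>A\<close>\<close>
    define f where
      "f k = (if k \<in> dom \<sigma> then x (the (\<sigma> k)) else y (SOME j. \<tau> j = Some k))" for k
    have A_sub: "A \<subseteq> ?\<Omega>" using \<sigma> \<tau> by (auto simp: A_def PB_def)
    have xP: "x i \<in> P" and yP: "y i \<in> P" if "i \<in> ?\<Omega>" for i
      using x y that by (auto simp: injections_def)
    have f_\<sigma>: "f k = x i" if "\<sigma> k = Some i" for k i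
      using that by (simp add: f_def dom_def)
    \<comment> \<open>On \<open>dom \<sigma> \<inter> ran \<tau>\<close> the two prescriptions agree, because \<open>\<kappa>\<close> extends \<open>\<sigma>\<tau>\<close>.\<close>
    have f_\<tau>: "f k = y j" if j: "\<tau> j = Some k" for k j
    proof (cases "k \<in> dom \<sigma>")
      case True
      then obtain i where "\<sigma> k = Some i" by auto
      with adm j have "\<kappa> j = Some i" by blast
      with \<kappa>_iff f_\<sigma>[OF \<open>\<sigma> k = Some i\<close>] show ?thesis by simp
    next
      case False
      have "(SOME j. \<tau> j = Some k) = j" using j PB_D(3)[OF \<tau>] by blast
      with False show ?thesis by (simp add: f_def)
    qed
    have A_cases: "(\<exists>i. \<sigma> k = Some i) \<or> (\<exists>j. \<tau> j = Some k)" if "k \<in> A" for k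
      using that by (auto simp: A_def ran_def)
    \<comment> \<open>The forced values create no coincidence with \<open>x\<close> or \<open>y\<close> beyond those in \<open>\<sigma>\<close> and \<open>\<tau>\<close>.\<close>
    have f_eq_x: "\<sigma> k = Some i" if k: "k \<in> A" and i: "i \<in> ?\<Omega>" and eq: "x i = f k" for k i
      using A_cases[OF k]
    proof (elim disjE exE)
      fix i' assume i': "\<sigma> k = Some i'"
      with eq f_\<sigma>[OF i'] injections_eqD[OF x i PB_D(2)[OF \<sigma> i']] show ?thesis by simp
    next
      fix j assume j: "\<tau> j = Some k"
      with eq f_\<tau>[OF j] i PB_D(1)[OF \<tau> j] have "\<kappa> j = Some i" unfolding \<kappa>_iff by simp
      with adm j show ?thesis by blast
    qed
    have f_eq_y: "\<tau> j = Some k" if k: "k \<in> A" and j: "j \<in> ?\<Omega>" and eq: "f k = y j" for k j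
      using A_cases[OF k]
    proof (elim disjE exE)
      fix i assume i: "\<sigma> k = Some i"
      with eq f_\<sigma>[OF i] j PB_D(2)[OF \<sigma> i] have "\<kappa> j = Some i" unfolding \<kappa>_iff by simp
      with adm i show ?thesis by blast
    next
      fix j' assume j': "\<tau> j' = Some k"
      with eq f_\<tau>[OF j'] injections_eqD[OF y j PB_D(1)[OF \<tau> j']] show ?thesis by simp
    qed
    have f_range: "f k \<in> x ` ?\<Omega> \<union> y ` ?\<Omega>" if "k \<in> A" for k
      using A_cases[OF that]
    proof (elim disjE exE)
      fix i assume i: "\<sigma> k = Some i"
      from f_\<sigma>[OF i] PB_D(2)[OF \<sigma> i] show ?thesis by (simp del: atLeastAtMost_iff)
    next
      fix j assume j: "\<tau> j = Some k"
      from f_\<tau>[OF j] PB_D(1)[OF \<tau> j] show ?thesis by (simp del: atLeastAtMost_iff)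
    qed
    have f_inj: "inj_on f A"
    proof (rule inj_onI)
      fix k k' assume kk: "k \<in> A" "k' \<in> A" "f k = f k'"
      from A_cases[OF kk(1)] show "k = k'"
      proof (elim disjE exE)
        fix i assume i: "\<sigma> k = Some i"
        then have "\<sigma> k' = Some i"
          using f_eq_x[OF kk(2) PB_D(2)[OF \<sigma> i]] f_\<sigma>[OF i] kk(3) by simp
        with i PB_D(3)[OF \<sigma>] show ?thesis by blast
      next
        fix j assume j: "\<tau> j = Some k"
        then have "\<tau> j = Some k'"
          using f_eq_y[OF kk(2) PB_D(1)[OF \<tau> j]] f_\<tau>[OF j] kk(3) by simp
        with j show ?thesis by simp
      qed
    qed
    let ?G = "{g \<in> (?\<Omega> - A) \<rightarrow>\<^sub>E Q. inj_on g (?\<Omega> - A)}"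
    define glue where "glue g k = (if k \<in> A then f k else g k)" for g k
    have Z_on_A: "z k = f k" if z: "z \<in> ?Z" and k: "k \<in> A" for z k
      using A_cases[OF k]
    proof (elim disjE exE)
      fix i assume i: "\<sigma> k = Some i"
      have "x i = z k" using i unfolding Z\<sigma>[OF z] by simp
      with f_\<sigma>[OF i] show ?thesis by simp
    next
      fix j assume j: "\<tau> j = Some k"
      have "z k = y j" using j unfolding Z\<tau>[OF z] by simp
      with f_\<tau>[OF j] show ?thesis by simp
    qed
    have Z_off_A: "z k \<in> Q" if z: "z \<in> ?Z" and k: "k \<in> ?\<Omega> - A" for z k
    proof -
      have "z k \<in> P" using z k by (auto simp: injections_def)
      moreover have "z k \<notin> x ` ?\<Omega>"
      proof
        assume "z k \<in> x ` ?\<Omega>"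
        then obtain i where "i \<in> ?\<Omega>" "x i = z k" by (metis imageE)
        then have "\<sigma> k = Some i" using k unfolding Z\<sigma>[OF z] by simp
        with k show False by (auto simp: A_def)
      qed
      moreover have "z k \<notin> y ` ?\<Omega>"
      proof
        assume "z k \<in> y ` ?\<Omega>"
        then obtain j where "j \<in> ?\<Omega>" "z k = y j" by (metis imageE)
        then have "\<tau> j = Some k" using k unfolding Z\<tau>[OF z] by simp
        with k show False by (auto simp: A_def ran_def)
      qed
      ultimately show ?thesis by (simp add: Q_def)
    qed
    have restrict_in_G: "restrict z (?\<Omega> - A) \<in> ?G" if z: "z \<in> ?Z" for z
    proof -
      have "inj_on z (?\<Omega> - A)"
        using z by (auto simp: injections_def intro: inj_on_subset)
      then show ?thesis using Z_off_A[OF z] by (simp del: atLeastAtMost_iff)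
    qed
    have glue_in_Z: "glue g \<in> ?Z" if g: "g \<in> ?G" for g
    proof -
        have gQ: "g k \<in> Q" if "k \<in> ?\<Omega>" "k \<notin> A" for k using g that by blast
      have glue_A: "glue g k = f k" if "k \<in> A" for k using that by (simp add: glue_def)
      have glue_Q: "glue g k \<in> Q" if "k \<in> ?\<Omega>" "k \<notin> A" for k
        using gQ[OF that] that(2) by (simp add: glue_def)
      have Q_disj: "x i \<notin> Q" "y i \<notin> Q" if "i \<in> ?\<Omega>" for i using that by (simp_all add: Q_def)
      have inj: "inj_on (glue g) ?\<Omega>"
      proof -
        have "inj_on (glue g) (A \<union> (?\<Omega> - A))"
          unfolding inj_on_Un
        proof (intro conjI)
          show "inj_on (glue g) A"
            using f_inj by (simp add: glue_def cong: inj_on_cong)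
          have "inj_on g (?\<Omega> - A)" using g by simp
          then show "inj_on (glue g) (?\<Omega> - A)"
            by (rule inj_on_cong[THEN iffD1, rotated]) (simp add: glue_def)
          show "glue g ` (A - (?\<Omega> - A)) \<inter> glue g ` (?\<Omega> - A - A) = {}"
          proof -
            have "glue g ` A \<subseteq> x ` ?\<Omega> \<union> y ` ?\<Omega>" by (rule image_subsetI) (simp only: glue_A f_range)
            moreover have "glue g ` (?\<Omega> - A) \<subseteq> Q" using glue_Q by blast
            moreover have "(x ` ?\<Omega> \<union> y ` ?\<Omega>) \<inter> Q = {}" unfolding Q_def by blast
            ultimately show ?thesis by blast
          qed
        qed
        then show ?thesis using A_sub by (simp add: Un_absorb1)
      qed
      have "glue g \<in> ?\<Omega> \<rightarrow>\<^sub>E P"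
      proof (rule PiE_I)
        fix k assume k: "k \<in> ?\<Omega>"
        show "glue g k \<in> P"
        proof (cases "k \<in> A")
          case True
          have "x ` ?\<Omega> \<union> y ` ?\<Omega> \<subseteq> P" using xP yP by blast
          with f_range[OF True] show ?thesis unfolding glue_A[OF True] by blast
        next
          case False
          from glue_Q[OF k False] show ?thesis unfolding Q_def by blast
        qed
      next
        fix k assume k: "k \<notin> ?\<Omega>"
        then have "k \<notin> A" using A_sub by blast
        moreover have "g k = undefined" using PiE_arb[of g _ _ k] g k by blast
        ultimately show "glue g k = undefined" by (simp add: glue_def)
      qed
      with inj have 1: "glue g \<in> injections \<alpha> P" by (simp add: injections_def)
      have 2: "\<sigma> k = Some i \<longleftrightarrow> i \<in> ?\<Omega> \<and> k \<in> ?\<Omega> \<and> x i = glue g k" for i k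
      proof
        assume i: "\<sigma> k = Some i"
        then have "k \<in> A" by (auto simp: A_def)
        with i f_\<sigma>[OF i] PB_D(1,2)[OF \<sigma> i]
        show "i \<in> ?\<Omega> \<and> k \<in> ?\<Omega> \<and> x i = glue g k" by (simp add: glue_def)
      next
        assume r: "i \<in> ?\<Omega> \<and> k \<in> ?\<Omega> \<and> x i = glue g k"
        then have "k \<in> A" using glue_Q[of k] Q_disj(1)[of i] by metis
        with r f_eq_x[of k i] glue_A[of k] show "\<sigma> k = Some i" by simp
      qed
      have 3: "\<tau> j = Some k \<longleftrightarrow> k \<in> ?\<Omega> \<and> j \<in> ?\<Omega> \<and> glue g k = y j" for j k
      proof
        assume j: "\<tau> j = Some k"
        then have "k \<in> A" by (auto simp: A_def ran_def)
        with j f_\<tau>[OF j] PB_D(1,2)[OF \<tau> j]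
        show "k \<in> ?\<Omega> \<and> j \<in> ?\<Omega> \<and> glue g k = y j" by (simp add: glue_def)
      next
        assume r: "k \<in> ?\<Omega> \<and> j \<in> ?\<Omega> \<and> glue g k = y j"
        then have "k \<in> A" using glue_Q[of k] Q_disj(2)[of j] by metis
        with r f_eq_y[of k j] glue_A[of k] show "\<tau> j = Some k" by simp
      qed
      show ?thesis unfolding Z_iff by (intro conjI allI 1 2 3)
    qed
    have "bij_betw (\<lambda>z. restrict z (?\<Omega> - A)) ?Z ?G"
    proof (rule bij_betw_byWitness[where f' = glue])
      show "\<forall>z\<in>?Z. glue (restrict z (?\<Omega> - A)) = z"
      proof (intro ballI ext)
        fix z k assume z: "z \<in> ?Z"
        have "z k = undefined" if "k \<notin> ?\<Omega>"
          using PiE_arb[of z _ _ k] z that unfolding injections_def by blast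
        with Z_on_A[OF z] show "glue (restrict z (?\<Omega> - A)) k = z k"
          by (simp add: glue_def restrict_def)
      qed
      show "\<forall>g\<in>?G. restrict (glue g) (?\<Omega> - A) = g"
      proof (intro ballI ext)
        fix g k assume g: "g \<in> ?G"
        have "g k = undefined" if "k \<notin> ?\<Omega> - A"
          using PiE_arb[of g _ _ k] g that by blast
        then show "restrict (glue g) (?\<Omega> - A) k = g k"
          by (simp add: glue_def restrict_def)
      qed
    qed (use restrict_in_G glue_in_Z in blast)+
    then have "card ?Z = card ?G" by (rule bij_betw_same_card)
    also have "\<dots> = (\<Prod>i<card (?\<Omega> - A). card Q - i)"
      by (subst card_inj_on_subset_funcset) (use P(1) in \<open>auto simp: Q_def atLeast0LessThan\<close>)
    finally have "card ?Z = (\<Prod>i<card (?\<Omega> - A). card Q - i)" .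
    then have "(of_nat (card ?Z) :: complex) = (\<Prod>i<card (?\<Omega> - A). of_nat (card Q) - of_nat i)"
      by (simp only: of_nat_prod_diff)
    moreover have "card (?\<Omega> - A) = nat (num_factors \<alpha> \<sigma> \<tau>)"
      by (simp add: num_factors_eq_card[OF \<sigma> \<tau>] A_def)
    moreover have "(of_nat (card Q) :: complex) = of_nat n - of_nat \<alpha> + of_nat (rk \<kappa>)"
    proof -
      have sub: "x ` ?\<Omega> \<union> y ` ?\<Omega> \<subseteq> P" using xP yP by blast
      have "card Q + card (x ` ?\<Omega> \<union> y ` ?\<Omega>) = card P"
        unfolding Q_def using card_Diff_subset[OF _ sub] card_mono[OF P(1) sub] by simp
      then have "card Q + \<alpha> = n + rk \<kappa>"
        using card_image_Un[OF x y] P(2) by (simp add: \<kappa>_def)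
      then have "(of_nat (card Q + \<alpha>) :: complex) = of_nat (n + rk \<kappa>)" by simp
      then show ?thesis by (simp add: algebra_simps)
    qed
    ultimately show ?thesis
      using True prod_factor_shifts[of \<alpha> \<sigma> \<tau> "of_nat n :: complex" \<kappa>] num_factors_eq_card[OF \<sigma> \<tau>]
      by (simp add: struct_const_def flip: \<kappa>_def)
  qed
qed


lemma sum_fibres:
  fixes h :: "'b \<Rightarrow> 'c::comm_semiring_1"
  assumes "finite A" "finite B" "\<And>w. w \<in> A \<Longrightarrow> p w \<in> B"
  shows "(\<Sum>w\<in>A. h (p w)) = (\<Sum>\<theta>\<in>B. h \<theta> * of_nat (card {w \<in> A. p w = \<theta>}))"
proof -
  have "(\<Sum>w\<in>A. h (p w)) = (\<Sum>\<theta>\<in>B. \<Sum>w | w \<in> A \<and> p w = \<theta>. h (p w))"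
    by (rule sum.group[symmetric]) (use assms in auto)
  also have "\<dots> = (\<Sum>\<theta>\<in>B. h \<theta> * of_nat (card {w \<in> A. p w = \<theta>}))"
    by (intro sum.cong refl) (simp add: mult.commute)
  finally show ?thesis .
qed

text \<open>Both sides count the paths \<open>x, z, w, y\<close> of injections whose consecutive patterns are
  \<open>\<sigma>\<close>, \<open>\<tau>\<close>, \<open>\<rho>\<close>. The left side sorts them by the pattern \<open>\<theta>\<close> of \<open>(x, w)\<close>, the right side by the
  pattern \<open>\<mu>\<close> of \<open>(z, y)\<close>. This works because the number of middle injections depends only on the
  pattern of the outer pair.\<close>
lemma struct_const_assoc_of_nat:
  assumes "\<alpha> \<le> n" and \<sigma>: "\<sigma> \<in> PB \<alpha>" and \<tau>: "\<tau> \<in> PB \<alpha>" and \<rho>: "\<rho> \<in> PB \<alpha>" and "\<kappa> \<in> PB \<alpha>"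
  shows "(\<Sum>\<theta>\<in>PB \<alpha>. struct_const \<alpha> (of_nat n) \<sigma> \<tau> \<theta> * struct_const \<alpha> (of_nat n) \<theta> \<rho> \<kappa>) =
    (\<Sum>\<mu>\<in>PB \<alpha>. struct_const \<alpha> (of_nat n) \<tau> \<rho> \<mu> * struct_const \<alpha> (of_nat n) \<sigma> \<mu> \<kappa>)"
proof -
  let ?c = "struct_const \<alpha> (of_nat n)"
  define P where "P = {1..\<alpha> + n}"
  let ?I = "injections \<alpha> P"
  have P: "finite P" "card P = \<alpha> + n" by (simp_all add: P_def)
  have fin: "finite ?I" by (rule finite_injections[OF P(1)])
  obtain x y where x: "x \<in> ?I" and y: "y \<in> ?I" and \<kappa>: "pattern \<alpha> x y = \<kappa>"
    using pattern_surjective[OF assms(5,1)] unfolding P_def by blast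
  let ?N = "of_nat (card {(z, w). z \<in> ?I \<and> w \<in> ?I \<and> pattern \<alpha> x z = \<sigma> \<and>
      pattern \<alpha> z w = \<tau> \<and> pattern \<alpha> w y = \<rho>}) :: complex"
  have count: "of_nat (card {z \<in> ?I. pattern \<alpha> u z = \<beta> \<and> pattern \<alpha> z v = \<gamma>}) = ?c \<beta> \<gamma> (pattern \<alpha> u v)"
    if "u \<in> ?I" "v \<in> ?I" "\<beta> \<in> PB \<alpha>" "\<gamma> \<in> PB \<alpha>" for u v \<beta> \<gamma>
    by (rule card_middle_injections[OF that(1,2) P that(3,4)])
  have "?N = (\<Sum>\<theta>\<in>PB \<alpha>. ?c \<sigma> \<tau> \<theta> * ?c \<theta> \<rho> \<kappa>)"
  proof -
    let ?W = "{w \<in> ?I. pattern \<alpha> w y = \<rho>}"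
    \<comment> \<open>fix \<open>w\<close> first: the number of \<open>z\<close> depends only on the pattern of \<open>(x, w)\<close>\<close>
    have "{(z, w). z \<in> ?I \<and> w \<in> ?I \<and> pattern \<alpha> x z = \<sigma> \<and> pattern \<alpha> z w = \<tau> \<and> pattern \<alpha> w y = \<rho>} =
        prod.swap ` (SIGMA w:?W. {z \<in> ?I. pattern \<alpha> x z = \<sigma> \<and> pattern \<alpha> z w = \<tau>})"
      by (auto simp: image_iff)
    then have "?N = of_nat (card (SIGMA w:?W. {z \<in> ?I. pattern \<alpha> x z = \<sigma> \<and> pattern \<alpha> z w = \<tau>}))"
      by (simp add: card_image)
    also have "\<dots> = (\<Sum>w\<in>?W. ?c \<sigma> \<tau> (pattern \<alpha> x w))"
      using fin by (simp add: count[OF x _ \<sigma> \<tau>])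
    also have "\<dots> = (\<Sum>\<theta>\<in>PB \<alpha>. ?c \<sigma> \<tau> \<theta> * of_nat (card {w \<in> ?W. pattern \<alpha> x w = \<theta>}))"
      using fin finite_PB by (intro sum_fibres) (auto intro: pattern_in_PB[OF x])
    also have "\<dots> = (\<Sum>\<theta>\<in>PB \<alpha>. ?c \<sigma> \<tau> \<theta> * ?c \<theta> \<rho> \<kappa>)"
    proof (intro sum.cong refl)
      fix \<theta> assume "\<theta> \<in> PB \<alpha>"
      have "{w \<in> ?W. pattern \<alpha> x w = \<theta>} = {w \<in> ?I. pattern \<alpha> x w = \<theta> \<and> pattern \<alpha> w y = \<rho>}" by blast
      then show "?c \<sigma> \<tau> \<theta> * of_nat (card {w \<in> ?W. pattern \<alpha> x w = \<theta>}) = ?c \<sigma> \<tau> \<theta> * ?c \<theta> \<rho> \<kappa>"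
        by (simp only: count[OF x y \<open>\<theta> \<in> PB \<alpha>\<close> \<rho>] \<kappa>)
    qed
    finally show ?thesis .
  qed
  moreover have "?N = (\<Sum>\<mu>\<in>PB \<alpha>. ?c \<tau> \<rho> \<mu> * ?c \<sigma> \<mu> \<kappa>)"
  proof -
    let ?W = "{z \<in> ?I. pattern \<alpha> x z = \<sigma>}"
    \<comment> \<open>fix \<open>z\<close> first: the number of \<open>w\<close> depends only on the pattern of \<open>(z, y)\<close>\<close>
    have "{(z, w). z \<in> ?I \<and> w \<in> ?I \<and> pattern \<alpha> x z = \<sigma> \<and> pattern \<alpha> z w = \<tau> \<and> pattern \<alpha> w y = \<rho>} =
        (SIGMA z:?W. {w \<in> ?I. pattern \<alpha> z w = \<tau> \<and> pattern \<alpha> w y = \<rho>})"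
      by blast
    then have "?N = of_nat (card (SIGMA z:?W. {w \<in> ?I. pattern \<alpha> z w = \<tau> \<and> pattern \<alpha> w y = \<rho>}))"
      by (simp only:)
    also have "\<dots> = (\<Sum>z\<in>?W. ?c \<tau> \<rho> (pattern \<alpha> z y))"
      using fin by (simp add: count[OF _ y \<tau> \<rho>])
    also have "\<dots> = (\<Sum>\<mu>\<in>PB \<alpha>. ?c \<tau> \<rho> \<mu> * of_nat (card {z \<in> ?W. pattern \<alpha> z y = \<mu>}))"
      using fin finite_PB by (intro sum_fibres) (auto intro: pattern_in_PB[OF _ y])
    also have "\<dots> = (\<Sum>\<mu>\<in>PB \<alpha>. ?c \<tau> \<rho> \<mu> * ?c \<sigma> \<mu> \<kappa>)"
    proof (intro sum.cong refl)
      fix \<mu> assume "\<mu> \<in> PB \<alpha>"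
      have "{z \<in> ?W. pattern \<alpha> z y = \<mu>} = {z \<in> ?I. pattern \<alpha> x z = \<sigma> \<and> pattern \<alpha> z y = \<mu>}" by blast
      then show "?c \<tau> \<rho> \<mu> * of_nat (card {z \<in> ?W. pattern \<alpha> z y = \<mu>}) = ?c \<tau> \<rho> \<mu> * ?c \<sigma> \<mu> \<kappa>"
        by (simp only: count[OF x y \<sigma> \<open>\<mu> \<in> PB \<alpha>\<close>] \<kappa>)
    qed
    finally show ?thesis .
  qed
  ultimately show ?thesis by simp
qed

lemma poly_eq_of_nat_ge:
  fixes p q :: "'a::{comm_ring_1,ring_no_zero_divisors,ring_char_0} poly"
  assumes "\<And>n. N \<le> n \<Longrightarrow> poly p (of_nat n) = poly q (of_nat n)"
  shows "p = q"
proof (rule ccontr)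
  assume "p \<noteq> q"
  then have "finite {x. poly (p - q) x = 0}" by (intro poly_roots_finite) simp
  moreover have "of_nat ` {N..} \<subseteq> {x. poly (p - q) x = 0}" using assms by auto
  ultimately have "finite ((of_nat :: nat \<Rightarrow> 'a) ` {N..})" by (rule finite_subset[rotated])
  then have "finite {N..}" by (rule finite_imageD) (simp add: inj_on_def)
  then show False by (simp add: infinite_Ici)
qed

text \<open>The relation extends from natural numbers to all \<open>\<nu>\<close>, both sides being polynomial in \<open>\<nu>\<close>.\<close>
lemma struct_const_assoc:
  assumes "\<sigma> \<in> PB \<alpha>" "\<tau> \<in> PB \<alpha>" "\<rho> \<in> PB \<alpha>" "\<kappa> \<in> PB \<alpha>"
  shows "(\<Sum>\<theta>\<in>PB \<alpha>. struct_const \<alpha> \<nu> \<sigma> \<tau> \<theta> * struct_const \<alpha> \<nu> \<theta> \<rho> \<kappa>) =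
    (\<Sum>\<mu>\<in>PB \<alpha>. struct_const \<alpha> \<nu> \<tau> \<rho> \<mu> * struct_const \<alpha> \<nu> \<sigma> \<mu> \<kappa>)"
proof -
  obtain p where p: "struct_const \<alpha> \<nu> \<beta> \<gamma> \<delta> = poly (p \<beta> \<gamma> \<delta>) \<nu>" for \<nu> \<beta> \<gamma> \<delta>
    using struct_const_polynomial[of \<alpha>] by metis
  have "(\<Sum>\<theta>\<in>PB \<alpha>. p \<sigma> \<tau> \<theta> * p \<theta> \<rho> \<kappa>) = (\<Sum>\<mu>\<in>PB \<alpha>. p \<tau> \<rho> \<mu> * p \<sigma> \<mu> \<kappa>)"
    by (rule poly_eq_of_nat_ge[of \<alpha>])
       (use struct_const_assoc_of_nat[OF _ assms] in \<open>simp add: poly_sum flip: p\<close>)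
  then have "poly (\<Sum>\<theta>\<in>PB \<alpha>. p \<sigma> \<tau> \<theta> * p \<theta> \<rho> \<kappa>) \<nu> = poly (\<Sum>\<mu>\<in>PB \<alpha>. p \<tau> \<rho> \<mu> * p \<sigma> \<mu> \<kappa>) \<nu>"
    by simp
  then show ?thesis by (simp add: poly_sum p)
qed

section \<open>Algebras given by structure constants\<close>

definition product_from_constants ::
  "'b set \<Rightarrow> ('b \<Rightarrow> 'b \<Rightarrow> 'b \<Rightarrow> complex) \<Rightarrow> ('b \<Rightarrow> complex) \<Rightarrow> ('b \<Rightarrow> complex) \<Rightarrow> 'b \<Rightarrow> complex" where
  "product_from_constants B c f g k =
     (if k \<in> B then \<Sum>a\<in>B. \<Sum>b\<in>B. f a * g b * c a b k else 0)"

lemma bilinear_product_from_constants: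
  "bilinear_product_on (coord_space B) (product_from_constants B c)"
  unfolding bilinear_product_on_def
  by (auto simp: product_from_constants_def coord_space_def scale_def fun_eq_iff
      algebra_simps sum.distrib sum_distrib_left)

lemma product_from_constants_Xi:
  assumes "finite B" "a \<in> B" "b \<in> B"
  shows "product_from_constants B c (Xi a) (Xi b) = (\<Sum>k\<in>B. scale (c a b k) (Xi k))"
proof
  fix k
  have "(\<Sum>a'\<in>B. \<Sum>b'\<in>B. Xi a a' * Xi b b' * c a' b' k) =
      (\<Sum>a'\<in>B. if a' = a then (\<Sum>b'\<in>B. if b' = b then c a' b' k else 0) else 0)"
    by (intro sum.cong refl) (auto simp: Xi_def intro!: sum.cong)
  also have "\<dots> = c a b k" using assms by simp
  finally show "product_from_constants B c (Xi a) (Xi b) k = (\<Sum>k\<in>B. scale (c a b k) (Xi k)) k"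
    using assms(1)
    by (simp add: product_from_constants_def sum_fun_apply scale_def Xi_def if_distrib cong: if_cong)
qed

text \<open>Associativity on basis vectors extends trilinearly: after expansion both triple products are
  sums over \<open>a\<close>, \<open>b\<close>, \<open>d\<close> of \<open>f a * g b * h d\<close> times the two sides of the hypothesis.\<close>
lemma product_from_constants_assoc:
  assumes fin: "finite B"
    and assoc: "\<And>a b d k. a \<in> B \<Longrightarrow> b \<in> B \<Longrightarrow> d \<in> B \<Longrightarrow> k \<in> B \<Longrightarrow>
      (\<Sum>l\<in>B. c a b l * c l d k) = (\<Sum>m\<in>B. c b d m * c a m k)"
  defines "mul \<equiv> product_from_constants B c"
  shows "mul (mul f g) h = mul f (mul g h)"
proof
  fix k
  show "mul (mul f g) h k = mul f (mul g h) k"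
  proof (cases "k \<in> B")
    case True
    have "mul (mul f g) h k =
        (\<Sum>l\<in>B. \<Sum>d\<in>B. \<Sum>a\<in>B. \<Sum>b\<in>B. f a * g b * h d * (c a b l * c l d k))"
      using True
      by (simp add: mul_def product_from_constants_def sum_distrib_left sum_distrib_right mult_ac)
    also have "\<dots> = (\<Sum>d\<in>B. \<Sum>l\<in>B. \<Sum>a\<in>B. \<Sum>b\<in>B. f a * g b * h d * (c a b l * c l d k))"
      by (rule sum.swap)
    also have "\<dots> = (\<Sum>d\<in>B. \<Sum>a\<in>B. \<Sum>b\<in>B. \<Sum>l\<in>B. f a * g b * h d * (c a b l * c l d k))"
      by (rule sum.cong[OF refl], subst sum.swap, rule sum.cong[OF refl], rule sum.swap)
    also have "\<dots> = (\<Sum>d\<in>B. \<Sum>a\<in>B. \<Sum>b\<in>B. f a * g b * h d * (\<Sum>l\<in>B. c a b l * c l d k))"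
      by (simp add: sum_distrib_left)
    also have "\<dots> = (\<Sum>d\<in>B. \<Sum>a\<in>B. \<Sum>b\<in>B. f a * g b * h d * (\<Sum>m\<in>B. c b d m * c a m k))"
      by (intro sum.cong refl) (simp only: assoc[OF _ _ _ True])
    also have "\<dots> = (\<Sum>a\<in>B. \<Sum>d\<in>B. \<Sum>b\<in>B. f a * g b * h d * (\<Sum>m\<in>B. c b d m * c a m k))"
      by (rule sum.swap)
    also have "\<dots> = (\<Sum>a\<in>B. \<Sum>b\<in>B. \<Sum>d\<in>B. f a * g b * h d * (\<Sum>m\<in>B. c b d m * c a m k))"
      by (rule sum.cong[OF refl], rule sum.swap)
    also have "\<dots> = (\<Sum>a\<in>B. \<Sum>b\<in>B. \<Sum>d\<in>B. \<Sum>m\<in>B. f a * g b * h d * (c b d m * c a m k))"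
      by (simp add: sum_distrib_left)
    also have "\<dots> = (\<Sum>a\<in>B. \<Sum>b\<in>B. \<Sum>m\<in>B. \<Sum>d\<in>B. f a * g b * h d * (c b d m * c a m k))"
      by (rule sum.cong[OF refl], rule sum.cong[OF refl], rule sum.swap)
    also have "\<dots> = (\<Sum>a\<in>B. \<Sum>m\<in>B. \<Sum>b\<in>B. \<Sum>d\<in>B. f a * g b * h d * (c b d m * c a m k))"
      by (rule sum.cong[OF refl], rule sum.swap)
    also have "\<dots> = mul f (mul g h) k"
      using True by (simp add: mul_def product_from_constants_def sum_distrib_left sum_distrib_right mult_ac)
    finally show ?thesis .
  qed (simp add: mul_def product_from_constants_def)
qed

text \<open>Linearity of \<open>L\<close> is only required on the coordinate space, since a product that is bilinear
  on that space is arbitrary elsewhere.\<close>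
lemma linear_on_coord_space_expand:
  assumes fin: "finite B" and x: "x \<in> coord_space B"
    and add: "\<And>u v. u \<in> coord_space B \<Longrightarrow> v \<in> coord_space B \<Longrightarrow> L (u + v) = L u + L v"
    and sc: "\<And>r u. u \<in> coord_space B \<Longrightarrow> L (scale r u) = scale r (L u)"
  shows "L x = (\<Sum>b\<in>B. scale (x b) (L (Xi b)))"
proof -
  have zero: "0 \<in> coord_space B" by (simp add: coord_space_def)
  have Xi: "scale r (Xi b) \<in> coord_space B" "Xi b \<in> coord_space B" if "b \<in> B" for r b
    using that by (auto simp: coord_space_def scale_def Xi_def)
  have "L (\<Sum>b\<in>C. scale (x b) (Xi b)) = (\<Sum>b\<in>C. scale (x b) (L (Xi b)))" if "finite C" "C \<subseteq> B" for C
    using that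
  proof (induction C rule: finite_induct)
    case empty
    have "L (scale 0 0) = scale 0 (L 0)" by (rule sc[OF zero])
    then show ?case by (simp only: sum.empty fun_space.scale_zero_left)
  next
    case (insert b C)
    have "(\<Sum>b\<in>C. scale (x b) (Xi b)) \<in> coord_space B"
      using insert.prems Xi(1)
      by (intro fun_space.subspace_sum[OF subspace_coord_space]) blast
    moreover have "b \<in> B" using insert.prems by simp
    moreover have "L (\<Sum>b\<in>C. scale (x b) (Xi b)) = (\<Sum>b\<in>C. scale (x b) (L (Xi b)))"
      using insert by simp
    ultimately show ?case
      by (simp only: sum.insert[OF insert.hyps] add[OF Xi(1)] sc[OF Xi(2)])
  qed
  from this[OF fin subset_refl] show ?thesis
    by (simp flip: coord_space_expand[OF fin x])
qed

lemma bilinear_product_on_expand: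
  assumes fin: "finite B" and bil: "bilinear_product_on (coord_space B) mul"
    and x: "x \<in> coord_space B" and y: "y \<in> coord_space B"
  shows "mul x y = (\<Sum>a\<in>B. scale (x a) (\<Sum>b\<in>B. scale (y b) (mul (Xi a) (Xi b))))"
proof -
  have Xi: "Xi b \<in> coord_space B" if "b \<in> B" for b
    using that by (auto simp: coord_space_def Xi_def)
  have "mul x y = (\<Sum>a\<in>B. scale (x a) (mul (Xi a) y))"
    using bil y unfolding bilinear_product_on_def
    by (intro linear_on_coord_space_expand[OF fin x, where L = "\<lambda>u. mul u y"]) blast+
  also have "\<dots> = (\<Sum>a\<in>B. scale (x a) (\<Sum>b\<in>B. scale (y b) (mul (Xi a) (Xi b))))"
  proof (intro sum.cong refl)
    fix a assume "a \<in> B"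
    have "mul (Xi a) y = (\<Sum>b\<in>B. scale (y b) (mul (Xi a) (Xi b)))"
      using bil Xi[OF \<open>a \<in> B\<close>] unfolding bilinear_product_on_def
      by (intro linear_on_coord_space_expand[OF fin y, where L = "mul (Xi a)"]) blast+
    then show "scale (x a) (mul (Xi a) y) = scale (x a) (\<Sum>b\<in>B. scale (y b) (mul (Xi a) (Xi b)))"
      by simp
  qed
  finally show ?thesis .
qed

lemma bilinear_product_on_unique:
  assumes "finite B" "bilinear_product_on (coord_space B) mul" "bilinear_product_on (coord_space B) mul'"
    and "\<And>a b. a \<in> B \<Longrightarrow> b \<in> B \<Longrightarrow> mul (Xi a) (Xi b) = mul' (Xi a) (Xi b)"
    and "x \<in> coord_space B" "y \<in> coord_space B"
  shows "mul x y = mul' x y"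
  using assms(4)
  by (simp add: bilinear_product_on_expand[OF assms(1,2,5,6)]
      bilinear_product_on_expand[OF assms(1,3,5,6)] cong: sum.cong)

section \<open>The associative algebra\<close>

theorem theorem3p1:
  fixes \<alpha> :: nat and \<nu> :: complex
  assumes "1 \<le> \<alpha>"
  shows "(\<forall>\<sigma>\<in>PB \<alpha>. \<forall>\<tau>\<in>PB \<alpha>. 0 \<le> num_factors \<alpha> \<sigma> \<tau>) \<and>
    (\<forall>\<sigma>\<in>PB \<alpha>. \<forall>\<tau>\<in>PB \<alpha>. \<forall>\<kappa>\<in>PB \<alpha>. admissible \<sigma> \<tau> \<kappa> \<longrightarrow>
       int (card (factor_shifts \<alpha> \<sigma> \<tau> \<kappa>)) = num_factors \<alpha> \<sigma> \<tau> \<and>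
       struct_const \<alpha> \<nu> \<sigma> \<tau> \<kappa> =
         (-1) ^ nat (num_factors \<alpha> \<sigma> \<tau>) *
         pochhammer (- \<nu> + of_nat \<alpha> - of_nat (rk \<kappa>)) (nat (num_factors \<alpha> \<sigma> \<tau>))) \<and>
    (\<exists>mul. associative_algebra_on (coord_space (PB \<alpha>)) mul \<and> product_formula \<alpha> \<nu> mul \<and>
       (\<forall>mul'. bilinear_product_on (coord_space (PB \<alpha>)) mul' \<and> product_formula \<alpha> \<nu> mul' \<longrightarrow>
          (\<forall>x\<in>coord_space (PB \<alpha>). \<forall>y\<in>coord_space (PB \<alpha>). mul' x y = mul x y)))"
proof -
  let ?mul = "product_from_constants (PB \<alpha>) (struct_const \<alpha> \<nu>)"
  have nonneg: "0 \<le> num_factors \<alpha> \<sigma> \<tau>" if "\<sigma> \<in> PB \<alpha>" "\<tau> \<in> PB \<alpha>" for \<sigma> \<tau>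
    by (simp add: num_factors_eq_card[OF that])
  have bil: "bilinear_product_on (coord_space (PB \<alpha>)) ?mul"
    by (rule bilinear_product_from_constants)
  have formula: "product_formula \<alpha> \<nu> ?mul"
    by (simp add: product_formula_def product_from_constants_Xi[OF finite_PB])
  have "associative_algebra_on (coord_space (PB \<alpha>)) ?mul"
    unfolding associative_algebra_on_def
    using subspace_coord_space bil
      product_from_constants_assoc[OF finite_PB struct_const_assoc[where \<alpha> = \<alpha> and \<nu> = \<nu>]]
    by blast
  moreover have "mul' x y = ?mul x y"
    if "bilinear_product_on (coord_space (PB \<alpha>)) mul'" "product_formula \<alpha> \<nu> mul'"
      "x \<in> coord_space (PB \<alpha>)" "y \<in> coord_space (PB \<alpha>)" for mul' x y
    using that(2) formula
    by (intro bilinear_product_on_unique[OF finite_PB that(1) bil _ that(3,4)])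
       (simp add: product_formula_def)
  ultimately have "\<exists>mul. associative_algebra_on (coord_space (PB \<alpha>)) mul \<and> product_formula \<alpha> \<nu> mul \<and>
       (\<forall>mul'. bilinear_product_on (coord_space (PB \<alpha>)) mul' \<and> product_formula \<alpha> \<nu> mul' \<longrightarrow>
          (\<forall>x\<in>coord_space (PB \<alpha>). \<forall>y\<in>coord_space (PB \<alpha>). mul' x y = mul x y))"
    using formula by (intro exI[of _ ?mul]) simp
  then show ?thesis
    using nonneg by (simp add: card_factor_shifts struct_const_eq_pochhammer)
qed

end
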